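(* Let $n>2$ be an integer. Then \[ \frac{1}{n}+\frac{1}{n^2(n-1)}< b_{\max}(n)\leq \frac{4n}{(2n-1)^2}. \]
   Context: Let $\mathcal{M}_n[x]$ denote the set of monic polynomials of degree $n$ with integer coefficients, and for a polynomial $p$ and closed interval $I\subset\mathbb{R}$ let $\|p\|_I=\sup_{x\in I}|p(x)|$. The monic integer transfinite diameter of a closed interval $I$ is $t_M(I)=\lim_{n\to\infty}\inf_{p_n\in\mathcal{M}_n[x]}\|p_n\|_I^{1/n}$, and for $b>0$ write $t_M(b)=t_M([0,b])$. For an integer $n>1$ define $b_{\max}(n)=\sup\{\,b>\tfrac1n : t_M(b)=\tfrac1n\,\}$. *)

theory Defs
  imports Complex_Main "HOL-Computational_Algebra.Polynomial"
begin

definition monic_int_polys :: "nat \<Rightarrow> int poly set" where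
  "monic_int_polys n = {p. degree p = n \<and> lead_coeff p = 1}"

definition sup_norm_on :: "int poly \<Rightarrow> real set \<Rightarrow> real" where
  "sup_norm_on p I = (SUP x\<in>I. \<bar>poly (map_poly real_of_int p) x\<bar>)"

definition monic_int_transfinite_diameter :: "real set \<Rightarrow> real" where
  "monic_int_transfinite_diameter I =
     lim (\<lambda>n. INF p\<in>monic_int_polys n. root n (sup_norm_on p I))"

definition t_M :: "real \<Rightarrow> real" where
  "t_M b = monic_int_transfinite_diameter {0..b}"

definition b_max :: "nat \<Rightarrow> real" where
  "b_max n = Sup {b. b > 1 / real n \<and> t_M b = 1 / real n}"

end

theory Submission
  imports Defs "HOL-Complex_Analysis.Conformal_Mappings"
begin

text \<open>
  If \<open>p\<close> is monic of degree \<open>d\<close>, then \<open>m^d p(1/m)\<close> is an integer congruent to \<open>1\<close> modulo \<open>m\<close>, so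
  \<open>\<bar>p(1/m)\<bar> \<ge> m^(-d)\<close> for \<open>m \<ge> 2\<close>.  Hence \<open>t_M(b) \<ge> 1/n\<close> for \<open>b \<ge> 1/n\<close>.

  Lower bound: \<open>Q(x) = x^(n^2-2) (x^2 - n x + 1)\<close> has its maximum \<open>n^(-n^2)\<close> at \<open>1/n\<close>, and
  \<open>\<bar>Q\<bar>\<close> remains below this value slightly beyond \<open>1/n + 1/(n^2(n-1))\<close>.

  Upper bound: the point \<open>1/(n-1)\<close> lies outside \<open>[0,b]\<close> for \<open>b\<close> close to \<open>4n/(2n-1)^2\<close>, but by the
  Bernstein--Walsh inequality \<open>\<bar>p(1/(n-1))\<bar> \<ge> (n-1)^(-d)\<close> still forces \<open>p\<close> to be large on
  \<open>[0,b]\<close>; the critical \<open>b\<close> is the one at which the resulting bound on \<open>t_M(b)\<close> equals \<open>1/n\<close>.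
\<close>

section \<open>Integer polynomials: evaluation, products and sup norms\<close>

abbreviation eval_real :: "int poly \<Rightarrow> real \<Rightarrow> real" where
  "eval_real p x \<equiv> poly (map_poly real_of_int p) x"

lemma eval_real_mult: "eval_real (p * q) x = eval_real p x * eval_real q x"
proof -
  have "map_poly real_of_int (p * q) = map_poly real_of_int p * map_poly real_of_int q"
    by (intro poly_eqI) (simp add: coeff_map_poly coeff_mult)
  then show ?thesis by simp
qed

lemma eval_real_power: "eval_real (p ^ k) x = eval_real p x ^ k"
  by (induction k) (simp_all add: eval_real_mult)

lemma eval_real_monom: "eval_real (monom 1 k) x = x ^ k"
  by (simp add: map_poly_monom poly_monom)

lemma monic_int_polys_mult:
  assumes "p \<in> monic_int_polys k" "q \<in> monic_int_polys l"
  shows "p * q \<in> monic_int_polys (k + l)"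
proof -
  have "p \<noteq> 0" "q \<noteq> 0" using assms by (auto simp: monic_int_polys_def)
  then show ?thesis
    using assms lead_coeff_mult[of p q] by (auto simp: monic_int_polys_def degree_mult_eq)
qed

lemma monic_int_polys_power:
  assumes "p \<in> monic_int_polys m"
  shows "p ^ k \<in> monic_int_polys (k * m)"
proof (induction k)
  case 0
  show ?case by (simp add: monic_int_polys_def)
next
  case (Suc k)
  then show ?case using monic_int_polys_mult[OF assms Suc] by simp
qed

lemma monom_in_monic_int_polys: "monom 1 k \<in> monic_int_polys k"
  by (simp add: monic_int_polys_def degree_monom_eq)

lemma abs_eval_real_le_sup_norm_on:
  assumes "x \<in> {0..b}"
  shows "\<bar>eval_real p x\<bar> \<le> sup_norm_on p {0..b}"
proof -
  have "compact ((\<lambda>x. \<bar>eval_real p x\<bar>) ` {0..b})"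
    by (intro compact_continuous_image continuous_intros) auto
  then have "bdd_above ((\<lambda>x. \<bar>eval_real p x\<bar>) ` {0..b})"
    by (intro bounded_imp_bdd_above compact_imp_bounded)
  then show ?thesis
    unfolding sup_norm_on_def using assms by (intro cSUP_upper)
qed

lemma sup_norm_on_le:
  assumes "b \<ge> 0" "\<And>x. x \<in> {0..b} \<Longrightarrow> \<bar>eval_real p x\<bar> \<le> M"
  shows "sup_norm_on p {0..b} \<le> M"
  unfolding sup_norm_on_def using assms by (intro cSUP_least) auto

lemma sup_norm_on_nonneg: "b \<ge> 0 \<Longrightarrow> sup_norm_on p {0..b} \<ge> 0"
  using abs_eval_real_le_sup_norm_on[of 0 b p] by simp

section \<open>The limit defining \<open>t_M\<close> and how to bound it\<close>

abbreviation monic_min :: "real \<Rightarrow> nat \<Rightarrow> real" where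
  "monic_min b d \<equiv> INF p\<in>monic_int_polys d. root d (sup_norm_on p {0..b})"

lemma monic_min_le:
  assumes "b \<ge> 0" "p \<in> monic_int_polys d"
  shows "monic_min b d \<le> root d (sup_norm_on p {0..b})"
proof (rule cINF_lower[OF _ assms(2)])
  show "bdd_below ((\<lambda>p. root d (sup_norm_on p {0..b})) ` monic_int_polys d)"
    using assms by (intro bdd_belowI[of _ 0]) (auto intro!: real_root_ge_zero sup_norm_on_nonneg)
qed

lemma monic_min_nonneg:
  assumes "b \<ge> 0"
  shows "monic_min b d \<ge> 0"
  using assms monom_in_monic_int_polys[of d]
  by (intro cINF_greatest) (auto intro!: real_root_ge_zero sup_norm_on_nonneg)

text \<open>One polynomial of degree \<open>m\<close> controls every degree
  \<open>d = k * m + r\<close> through \<open>p ^ k * x ^ r\<close>. The cost of the leftover factor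
  is bounded independently of \<open>d\<close>, so its \<open>d\<close>-th root tends to 1.\<close>

lemma monic_min_le_mult_root:
  assumes b: "b \<ge> 0" and s: "s > 0" and m: "m > 0" and p: "p \<in> monic_int_polys m"
    and le: "sup_norm_on p {0..b} \<le> s ^ m" and d: "d > 0"
  shows "monic_min b d \<le> s * root d (max 1 (b / s) ^ m)"
proof -
  define k r where "k = d div m" and "r = d mod m"
  have dkr: "d = k * m + r" by (simp add: k_def r_def)
  have "r \<le> m" using m by (simp add: r_def less_imp_le)
  define q where "q = p ^ k * monom 1 r"
  have q: "q \<in> monic_int_polys d"
    unfolding q_def dkr
    by (intro monic_int_polys_mult monic_int_polys_power p monom_in_monic_int_polys)
  have "sup_norm_on q {0..b} \<le> s ^ d * max 1 (b / s) ^ m"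
  proof (rule sup_norm_on_le[OF b])
    fix x assume x: "x \<in> {0..b}"
    have "\<bar>eval_real p x\<bar> \<le> s ^ m"
      using abs_eval_real_le_sup_norm_on[OF x, of p] le by simp
    then have 1: "\<bar>eval_real p x\<bar> ^ k \<le> (s ^ m) ^ k"
      by (intro power_mono) auto
    \<comment> \<open>The leftover \<open>x ^ r\<close> exceeds \<open>s ^ r\<close> by a factor of
      at most \<open>max 1 (b / s) ^ r\<close>; taking the maximum with 1 lets the exponent be
      raised to \<open>m\<close>.\<close>
    have "x \<le> s * max 1 (b / s)"
      using x s by (auto simp: max_def field_simps)
    then have "x ^ r \<le> (s * max 1 (b / s)) ^ r"
      using x by (intro power_mono) auto
    also have "\<dots> \<le> s ^ r * max 1 (b / s) ^ m"
      unfolding power_mult_distrib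
      using s \<open>r \<le> m\<close> by (intro mult_left_mono power_increasing) auto
    finally have 2: "x ^ r \<le> s ^ r * max 1 (b / s) ^ m" .
    have "\<bar>eval_real q x\<bar> = \<bar>eval_real p x\<bar> ^ k * x ^ r"
      using x by (simp add: q_def eval_real_mult eval_real_power eval_real_monom abs_mult power_abs)
    also have "\<dots> \<le> (s ^ m) ^ k * (s ^ r * max 1 (b / s) ^ m)"
      using 1 2 x s by (intro mult_mono) auto
    also have "\<dots> = s ^ d * max 1 (b / s) ^ m"
      by (simp add: dkr power_add power_mult[symmetric] mult.commute)
    finally show "\<bar>eval_real q x\<bar> \<le> s ^ d * max 1 (b / s) ^ m" .
  qed
  then have "root d (sup_norm_on q {0..b}) \<le> root d (s ^ d * max 1 (b / s) ^ m)"
    using d by simp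
  also have "\<dots> = s * root d (max 1 (b / s) ^ m)"
    using d s by (simp add: real_root_mult real_root_power_cancel)
  finally show ?thesis
    using monic_min_le[OF b q] by linarith
qed

lemma mult_root_const_tendsto:
  fixes s c :: real
  shows "(\<lambda>d. s * root d (max 1 c ^ m)) \<longlonglongrightarrow> s"
  using tendsto_mult[OF tendsto_const[of s] LIMSEQ_root_const[of "max 1 c ^ m"]] by simp

text \<open>Since \<open>monic_min b d ^ d\<close> is submultiplicative in \<open>d\<close>, this is Fekete's lemma.\<close>

lemma monic_min_tendsto_t_M:
  assumes b: "b \<ge> 0"
  shows "monic_min b \<longlonglongrightarrow> t_M b"
proof -
  \<comment> \<open>Degree 0 is left out because \<open>root 0\<close> is constantly 0, which would
    force the infimum to be 0.\<close>
  define L where "L = (INF d\<in>{1..}. monic_min b d)"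
  have bdd: "bdd_below (monic_min b ` {1..})"
    using monic_min_nonneg[OF b] by (intro bdd_belowI[of _ 0]) auto
  have L_le: "L \<le> monic_min b d" if "d \<ge> 1" for d
    unfolding L_def using that bdd by (intro cINF_lower) auto
  have "L \<ge> 0"
    unfolding L_def by (rule cINF_greatest) (simp, rule monic_min_nonneg[OF b])
  have "monic_min b \<longlonglongrightarrow> L"
  proof (rule order_tendstoI)
    fix a assume "a < L"
    then show "\<forall>\<^sub>F d in sequentially. a < monic_min b d"
      using L_le by (intro eventually_sequentiallyI[of 1]) (meson less_le_trans)
  next
    fix a assume "L < a"
    then obtain s where s: "L < s" "s < a" using dense by blast
    have "s > 0" using \<open>L \<ge> 0\<close> s by simp
    obtain m where m: "m \<ge> 1" "monic_min b m < s"
      using s(1) bdd unfolding L_def by (subst (asm) cINF_less_iff) auto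
    have "\<exists>p\<in>monic_int_polys m. root m (sup_norm_on p {0..b}) < s"
    proof (rule ccontr)
      assume "\<not> ?thesis"
      then have "s \<le> monic_min b m"
        using monom_in_monic_int_polys[of m] by (intro cINF_greatest) (auto simp: not_less)
      then show False using m by simp
    qed
    then obtain p where p: "p \<in> monic_int_polys m" "root m (sup_norm_on p {0..b}) < s"
      by blast
    have "sup_norm_on p {0..b} = root m (sup_norm_on p {0..b}) ^ m"
      using m sup_norm_on_nonneg[OF b] by simp
    also have "\<dots> \<le> s ^ m"
      using p m sup_norm_on_nonneg[OF b] by (intro power_mono real_root_ge_zero) auto
    finally have le: "sup_norm_on p {0..b} \<le> s ^ m" .
    have "\<forall>\<^sub>F d in sequentially. s * root d (max 1 (b / s) ^ m) < a"
      using mult_root_const_tendsto s(2) by (rule order_tendstoD)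
    then show "\<forall>\<^sub>F d in sequentially. monic_min b d < a"
      using eventually_gt_at_top[of 0]
    proof eventually_elim
      case (elim d)
      then show ?case
        using monic_min_le_mult_root[OF b \<open>s > 0\<close> _ p(1) le, of d] m by simp
    qed
  qed
  moreover from this have "t_M b = L"
    unfolding t_M_def monic_int_transfinite_diameter_def by (rule limI)
  ultimately show ?thesis by simp
qed

text \<open>A single polynomial certifies an upper bound, since it majorises the whole sequence
  \<open>monic_min b\<close> by one with limit \<open>s\<close>.\<close>

lemma t_M_le:
  assumes "b \<ge> 0" "s > 0" "m > 0" "p \<in> monic_int_polys m" "sup_norm_on p {0..b} \<le> s ^ m"
  shows "t_M b \<le> s"
proof (rule LIMSEQ_le[OF monic_min_tendsto_t_M[OF assms(1)] mult_root_const_tendsto])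
  show "\<exists>N. \<forall>d\<ge>N. monic_min b d \<le> s * root d (max 1 (b / s) ^ m)"
    using monic_min_le_mult_root[OF assms] by (intro exI[of _ 1]) auto
qed

lemma t_M_ge:
  assumes b: "b \<ge> 0" and c: "c \<ge> 0"
    and ge: "\<And>d p. p \<in> monic_int_polys d \<Longrightarrow> c ^ d \<le> sup_norm_on p {0..b}"
  shows "c \<le> t_M b"
proof (rule LIMSEQ_le_const[OF monic_min_tendsto_t_M[OF b]])
  have "c \<le> monic_min b d" if "d \<ge> 1" for d
  proof (rule cINF_greatest)
    show "monic_int_polys d \<noteq> {}" using monom_in_monic_int_polys[of d] by auto
    fix p assume "p \<in> monic_int_polys d"
    then have "root d (c ^ d) \<le> root d (sup_norm_on p {0..b})"
      using ge that by simp
    then show "c \<le> root d (sup_norm_on p {0..b})"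
      using that c by (simp add: real_root_power_cancel)
  qed
  then show "\<exists>N. \<forall>d\<ge>N. c \<le> monic_min b d" by blast
qed

section \<open>Values at reciprocals of integers and lower bounds for \<open>t_M\<close>\<close>

lemma monic_int_poly_at_inverse_nat:
  assumes p: "p \<in> monic_int_polys d" and m: "m \<ge> 2"
  shows "(1 / real m) ^ d \<le> \<bar>eval_real p (1 / real m)\<bar>"
proof -
  define N where "N = (\<Sum>i\<le>d. coeff p i * int m ^ (d - i))"
  have deg: "degree p = d" and lc: "coeff p d = 1"
    using p by (auto simp: monic_int_polys_def)
  have "eval_real p (1 / real m) = (\<Sum>i\<le>d. of_int (coeff p i) * (1 / real m) ^ i)"
    by (simp add: poly_altdef degree_map_poly deg coeff_map_poly)
  also have "real m ^ d * \<dots> = of_int N"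
    unfolding N_def of_int_sum sum_distrib_left
  proof (rule sum.cong)
    fix i assume "i \<in> {..d}"
    then have "real m ^ d = real m ^ i * real m ^ (d - i)"
      by (simp add: power_add[symmetric])
    then show "real m ^ d * (of_int (coeff p i) * (1 / real m) ^ i) =
        of_int (coeff p i * int m ^ (d - i))"
      using m by (simp add: power_divide)
  qed simp
  finally have eq: "real m ^ d * eval_real p (1 / real m) = of_int N" .
  \<comment> \<open>Terms with \<open>i < d\<close> carry a factor \<open>m\<close>; the term
    \<open>i = d\<close> is the leading coefficient 1. So \<open>N\<close> is 1 modulo
    \<open>m\<close>, hence nonzero.\<close>
  have "int m dvd (\<Sum>i<d. coeff p i * int m ^ (d - i))"
    by (intro dvd_sum) (auto intro!: dvd_mult)
  moreover have "N = (\<Sum>i<d. coeff p i * int m ^ (d - i)) + 1"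
    by (simp add: N_def lessThan_Suc_atMost[symmetric] lc)
  ultimately have "int m dvd N - 1" by simp
  moreover have "\<not> int m dvd 1" using m by simp
  ultimately have "N \<noteq> 0" by auto
  then have "1 \<le> \<bar>of_int N :: real\<bar>" by linarith
  also have "\<dots> = real m ^ d * \<bar>eval_real p (1 / real m)\<bar>"
    unfolding eq[symmetric] by (simp add: abs_mult)
  finally show ?thesis using m by (simp add: power_divide field_simps)
qed

text \<open>
  The Joukowski-type map \<open>z \<mapsto> b (z+1)^2 / (4z)\<close> sends the unit circle to \<open>[0,b]\<close>.  Multiplying the
  pulled back polynomial by \<open>z^d\<close> removes the pole at \<open>0\<close>, and the maximum modulus principle applies
  on the unit disc.
\<close>

lemma Bernstein_Walsh_interval:
  fixes P :: "real poly"
  assumes b: "b \<ge> 0" and r: "0 < r" "r \<le> 1"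
    and le: "\<And>x. x \<in> {0..b} \<Longrightarrow> \<bar>poly P x\<bar> \<le> M"
  shows "r ^ degree P * \<bar>poly P (b * (1 + r)\<^sup>2 / (4 * r))\<bar> \<le> M"
proof -
  define d where "d = degree P"
  define g where "g = (\<lambda>z::complex. \<Sum>k\<le>d. of_real (coeff P k) *
      (of_real b * (z + 1)\<^sup>2 / 4) ^ k * z ^ (d - k))"
  \<comment> \<open>The condition is \<open>t = b (z+1)^2 / (4z)\<close> with the denominator
    cleared. It is used both on the unit circle and at \<open>z = r\<close>.\<close>
  have g_eq: "g z = z ^ d * of_real (poly P t)"
    if z: "of_real b * (z + 1)\<^sup>2 / 4 = z * of_real t" for z t
  proof -
    have "g z = (\<Sum>k\<le>d. z ^ d * of_real (coeff P k * t ^ k))"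
      unfolding g_def
    proof (rule sum.cong)
      fix k assume "k \<in> {..d}"
      then have "z ^ d = z ^ k * z ^ (d - k)"
        by (simp add: power_add[symmetric])
      then show "of_real (coeff P k) * (of_real b * (z + 1)\<^sup>2 / 4) ^ k * z ^ (d - k) =
          z ^ d * of_real (coeff P k * t ^ k)"
        unfolding z by (simp add: power_mult_distrib)
    qed simp
    then show ?thesis
      by (simp add: poly_altdef d_def sum_distrib_left)
  qed
  have "norm (g (of_real r)) \<le> M"
  proof (rule maximum_modulus_frontier[where S = "cball 0 1" and f = g])
    show "g holomorphic_on interior (cball 0 1)"
      unfolding g_def by (intro holomorphic_intros) auto
    show "continuous_on (closure (cball 0 1)) g"
      unfolding g_def by (intro continuous_intros) auto
    show "of_real r \<in> cball (0::complex) 1" using r by simp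
    fix z :: complex assume "z \<in> frontier (cball 0 1)"
    then have z: "norm z = 1" by (simp add: frontier_cball)
    define t where "t = b * (1 + Re z) / 2"
    \<comment> \<open>On the unit circle \<open>cnj z\<close> is \<open>1/z\<close>, so
      \<open>(z+1)^2 / z = 2 Re z + 2\<close> is real.\<close>
    have "z * cnj z = 1" using z by (simp add: complex_norm_square[symmetric])
    then have "(z + 1)\<^sup>2 = z * (z + cnj z + 2)"
      by (simp add: power2_eq_square algebra_simps)
    also have "z + cnj z = of_real (2 * Re z)" by (rule complex_add_cnj)
    finally have "(z + 1)\<^sup>2 = z * of_real (2 * Re z + 2)" by simp
    then have "of_real b * (z + 1)\<^sup>2 / 4 = z * of_real t"
      by (simp add: t_def field_simps)
    then have "norm (g z) = \<bar>poly P t\<bar>"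
      using z by (simp only: g_eq) (simp add: norm_mult norm_power)
    moreover have "\<bar>Re z\<bar> \<le> 1" using abs_Re_le_cmod[of z] z by simp
    then have "b * (1 + Re z) \<ge> 0" "b * (1 + Re z) \<le> b * 2"
      using b by (auto intro!: mult_nonneg_nonneg mult_left_mono)
    then have "t \<in> {0..b}" by (simp add: t_def)
    ultimately show "norm (g z) \<le> M" using le by simp
  qed simp
  moreover have "of_real b * (of_real r + 1)\<^sup>2 / 4 =
      (of_real r * of_real (b * (1 + r)\<^sup>2 / (4 * r)) :: complex)"
    using r by (simp add: field_simps)
  then have "norm (g (of_real r)) = r ^ d * \<bar>poly P (b * (1 + r)\<^sup>2 / (4 * r))\<bar>"
    using r by (subst g_eq) (simp_all add: norm_mult norm_power del: of_real_divide of_real_mult)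
  ultimately show ?thesis by (simp add: d_def)
qed

text \<open>If the Joukowski-type map for \<open>[0, B r]\<close> sends \<open>r\<close> to
  \<open>1/(n-1)\<close>, the arithmetic bound there gives \<open>t_M b >= r/(n-1)\<close> whenever
  \<open>B r < b\<close>. This beats \<open>1/n\<close> exactly when \<open>r > q = (n-1)/n\<close>,
  and \<open>B q\<close> is the threshold \<open>4n/(2n-1)^2\<close>. By continuity some
  \<open>r > q\<close> still has \<open>B r < b\<close>.\<close>

lemma t_M_gt_of_large:
  assumes n: "n > 2" and b: "b > 4 * real n / (2 * real n - 1)\<^sup>2"
  shows "t_M b > 1 / real n"
proof -
  define \<nu> where "\<nu> = real n"
  have \<nu>: "\<nu> \<ge> 3" using n by (simp add: \<nu>_def)
  \<comment> \<open>Obtained by solving \<open>B r * (1+r)^2 / (4r) = 1/(n-1)\<close>.\<close>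
  define B where "B = (\<lambda>r::real. 4 * r / ((\<nu> - 1) * (1 + r)\<^sup>2))"
  define q where "q = (\<nu> - 1) / \<nu>"
  have q: "0 < q" "q < 1" using \<nu> by (auto simp: q_def)
  have "1 + q = (2 * \<nu> - 1) / \<nu>" using \<nu> by (simp add: q_def field_simps)
  then have "B q = (\<nu> - 1) * (4 / \<nu>) / ((\<nu> - 1) * ((2 * \<nu> - 1) / \<nu>)\<^sup>2)"
    unfolding B_def by (simp add: q_def)
  also have "\<dots> = 4 / \<nu> / ((2 * \<nu> - 1) / \<nu>)\<^sup>2"
    using \<nu> by (intro mult_divide_mult_cancel_left) auto
  also have "\<dots> = 4 * \<nu> / (2 * \<nu> - 1)\<^sup>2"
    using \<nu> by (simp add: power2_eq_square)
  finally have "B q = 4 * \<nu> / (2 * \<nu> - 1)\<^sup>2" .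
  then have "B q < b" using b by (simp add: \<nu>_def)
  have "isCont B q"
    unfolding B_def using \<nu> q by (intro continuous_intros) auto
  then have "(B \<longlongrightarrow> B q) (at_right q)"
    by (simp add: isCont_def filterlim_at_split)
  then have "\<forall>\<^sub>F r in at_right q. B r < b"
    using \<open>B q < b\<close> by (rule order_tendstoD)
  moreover have "\<forall>\<^sub>F r in at_right q. r \<in> {q<..<1}"
    using q by (intro eventually_at_right_real)
  ultimately have "\<forall>\<^sub>F r in at_right q. B r < b \<and> q < r \<and> r < 1"
    by eventually_elim auto
  then obtain r where r: "B r < b" "q < r" "r < 1"
    using eventually_happens'[OF trivial_limit_at_right_real] by blast
  have "r > 0" using q r by simp
  have "B r \<ge> 0" using \<nu> \<open>r > 0\<close> by (simp add: B_def)
  have node: "B r * (1 + r)\<^sup>2 / (4 * r) = 1 / real (n - 1)"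
    using \<nu> \<open>r > 0\<close> n by (simp add: B_def \<nu>_def of_nat_diff)
  have "r / (\<nu> - 1) \<le> t_M b"
  proof (rule t_M_ge)
    show "b \<ge> 0" using \<open>B r \<ge> 0\<close> r by simp
    show "r / (\<nu> - 1) \<ge> 0" using \<open>r > 0\<close> \<nu> by simp
    fix d p assume p: "p \<in> monic_int_polys d"
    then have deg: "degree (map_poly real_of_int p) = d"
      by (simp add: degree_map_poly monic_int_polys_def)
    have "(r / (\<nu> - 1)) ^ d = r ^ d * (1 / real (n - 1)) ^ d"
      using n by (simp add: \<nu>_def power_divide of_nat_diff)
    also have "\<dots> \<le> r ^ d * \<bar>eval_real p (1 / real (n - 1))\<bar>"
      using \<open>r > 0\<close> n by (intro mult_left_mono monic_int_poly_at_inverse_nat p) auto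
    \<comment> \<open>Bernstein-Walsh is applied on the subinterval \<open>[0, B r]\<close> of
      \<open>[0, b]\<close>, so that the outer point is exactly \<open>1/(n-1)\<close>.\<close>
    also have "\<dots> \<le> sup_norm_on p {0..b}"
      unfolding node[symmetric] deg[symmetric]
      using \<open>r > 0\<close> r \<open>B r \<ge> 0\<close>
      by (intro Bernstein_Walsh_interval abs_eval_real_le_sup_norm_on) auto
    finally show "(r / (\<nu> - 1)) ^ d \<le> sup_norm_on p {0..b}" .
  qed
  moreover have "1 / \<nu> < r / (\<nu> - 1)"
    using r(2) \<nu> by (simp add: q_def field_simps)
  ultimately show ?thesis by (simp add: \<nu>_def)
qed

lemma t_M_ge_inverse_nat:
  assumes n: "n \<ge> 2" and b: "b \<ge> 1 / real n"
  shows "t_M b \<ge> 1 / real n"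
proof (rule t_M_ge)
  show "b \<ge> 0" using b by (meson divide_nonneg_nonneg of_nat_0_le_iff order_trans zero_le_one)
  fix d p assume "p \<in> monic_int_polys d"
  then have "(1 / real n) ^ d \<le> \<bar>eval_real p (1 / real n)\<bar>"
    using n by (rule monic_int_poly_at_inverse_nat)
  also have "\<dots> \<le> sup_norm_on p {0..b}"
    using b by (intro abs_eval_real_le_sup_norm_on) auto
  finally show "(1 / real n) ^ d \<le> sup_norm_on p {0..b}" .
qed simp

section \<open>The extremal polynomial and an interval on which it stays small\<close>

text \<open>\<open>rescaled_extremal n u = n^(n^2) Q(u/n)\<close> for the polynomial \<open>Q\<close> of the introduction.\<close>

definition rescaled_extremal :: "nat \<Rightarrow> real \<Rightarrow> real" where
  "rescaled_extremal n u = u ^ (n\<^sup>2 - 2) * (u\<^sup>2 - (real n)\<^sup>2 * u + (real n)\<^sup>2)"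

lemma nine_le_square: "n\<^sup>2 \<ge> 9" if "n > 2" for n :: nat
  using power_mono[of 3 n 2] that by simp

text \<open>The factored form shows the only nonzero critical points, \<open>1\<close> and
  \<open>n^2 - 2\<close>, and hence the monotonicity in between.\<close>

lemma DERIV_rescaled_extremal:
  assumes n: "n > 2"
  shows "(rescaled_extremal n has_real_derivative
    (real n)\<^sup>2 * u ^ (n\<^sup>2 - 3) * ((u - 1) * (u - ((real n)\<^sup>2 - 2)))) (at u)"
proof -
  define k where "k = n\<^sup>2 - 3"
  have k: "n\<^sup>2 - 2 = Suc k" "(real n)\<^sup>2 = real k + 3"
    using nine_le_square[OF n] by (auto simp: k_def of_nat_diff)
  define c where "c = (real n)\<^sup>2"
  have "((\<lambda>u. u\<^sup>2 - c * u + c) has_real_derivative 2 * u - c) (at u)"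
    by (auto intro!: derivative_eq_intros)
  from DERIV_mult[OF DERIV_pow[of "Suc k"] this]
  have "((\<lambda>u. u ^ Suc k * (u\<^sup>2 - c * u + c)) has_real_derivative
      real (Suc k) * u ^ k * (u\<^sup>2 - c * u + c) + (2 * u - c) * u ^ Suc k) (at u)"
    by simp
  moreover have "real (Suc k) * u ^ k * (u\<^sup>2 - c * u + c) + (2 * u - c) * u ^ Suc k =
      c * u ^ k * ((u - 1) * (u - (c - 2)))"
  proof -
    have "real (Suc k) = c - 2" using k by (simp add: c_def)
    then show ?thesis by (simp only: power_Suc) (simp add: algebra_simps power2_eq_square)
  qed
  ultimately show ?thesis
    by (simp add: rescaled_extremal_def[abs_def] k(1) c_def k_def)
qed

text \<open>The function rises from 0 at \<open>0\<close> to 1 at \<open>1\<close> and then falls up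
  to \<open>u1\<close>, so only its value at the right endpoint can break the bound.\<close>

lemma rescaled_extremal_bounded:
  assumes n: "n > 2" and u1: "1 \<le> u1" "u1 \<le> (real n)\<^sup>2 - 2"
    and ge: "rescaled_extremal n u1 \<ge> -1" and u: "u \<in> {0..u1}"
  shows "\<bar>rescaled_extremal n u\<bar> \<le> 1"
proof -
  let ?f = "rescaled_extremal n"
  have f1: "?f 1 = 1" by (simp add: rescaled_extremal_def)
  have f0: "?f 0 = 0"
    using nine_le_square[OF n] by (simp add: rescaled_extremal_def)
  have inc: "?f x \<le> ?f y" if "0 \<le> x" "x \<le> y" "y \<le> 1" for x y
  proof (rule DERIV_nonneg_imp_nondecreasing[OF \<open>x \<le> y\<close>])
    fix z assume z: "x \<le> z" "z \<le> y"
    have "(z - 1) * (z - ((real n)\<^sup>2 - 2)) \<ge> 0"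
      using z that u1 by (intro mult_nonpos_nonpos) auto
    then have "(real n)\<^sup>2 * z ^ (n\<^sup>2 - 3) * ((z - 1) * (z - ((real n)\<^sup>2 - 2))) \<ge> 0"
      using z that by (intro mult_nonneg_nonneg[OF mult_nonneg_nonneg]) auto
    then show "\<exists>D. DERIV ?f z :> D \<and> 0 \<le> D"
      using DERIV_rescaled_extremal[OF n, of z] by blast
  qed
  have dec: "?f y \<le> ?f x" if "1 \<le> x" "x \<le> y" "y \<le> u1" for x y
  proof (rule DERIV_nonpos_imp_nonincreasing[OF \<open>x \<le> y\<close>])
    fix z assume z: "x \<le> z" "z \<le> y"
    have "(z - 1) * (z - ((real n)\<^sup>2 - 2)) \<le> 0"
      using z that u1 by (intro mult_nonneg_nonpos) auto
    then have "(real n)\<^sup>2 * z ^ (n\<^sup>2 - 3) * ((z - 1) * (z - ((real n)\<^sup>2 - 2))) \<le> 0"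
      using z that by (intro mult_nonneg_nonpos[OF mult_nonneg_nonneg]) auto
    then show "\<exists>D. DERIV ?f z :> D \<and> D \<le> 0"
      using DERIV_rescaled_extremal[OF n, of z] by blast
  qed
  show ?thesis
  proof (cases "u \<le> 1")
    case True
    then show ?thesis using inc[of 0 u] inc[of u 1] u f0 f1 by auto
  next
    case False
    then show ?thesis using dec[of 1 u] dec[of u u1] u f1 ge by auto
  qed
qed

text \<open>At \<open>1 + w\<close> with \<open>w = 1/(n(n-1))\<close> the quadratic factor
  collapses to \<open>w^2 - (n-2) w >= -1/6\<close>, while the power factor is below 6.\<close>

lemma rescaled_extremal_gt:
  assumes n: "n > 2"
  shows "rescaled_extremal n (1 + 1 / (real n * (real n - 1))) > -1"
proof -
  define \<nu> where "\<nu> = real n"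
  have \<nu>: "\<nu> \<ge> 3" using n by (simp add: \<nu>_def)
  define w where "w = 1 / (\<nu> * (\<nu> - 1))"
  have w: "w > 0" "\<nu> * (\<nu> - 1) * w = 1" using \<nu> by (auto simp: w_def)
  have "n = 3 \<or> n \<ge> 4" using n by auto
  \<comment> \<open>Integrality of \<open>n\<close> matters here: the product is negative strictly
    between 3 and 4. Both inequalities in \<open>le\<close> are rearrangements of it.\<close>
  then have "(\<nu> - 3) * (\<nu> - 4) \<ge> 0" by (auto simp: \<nu>_def)
  then have le: "6 * (\<nu> - 2) \<le> \<nu> * (\<nu> - 1)" "6 * (\<nu>\<^sup>2 - 2) \<le> 7 * (\<nu> * (\<nu> - 1))"
    by (auto simp: algebra_simps power2_eq_square)
  have w1: "(\<nu> - 2) * w \<le> 1 / 6"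
    using mult_right_mono[OF le(1), of w] w by (simp add: algebra_simps)
  \<comment> \<open>The constant \<open>7/6\<close> is relaxed to \<open>3/2\<close> so that
    squaring the exponential leaves \<open>exp 1 ^ 3 <= 27 < 36\<close>.\<close>
  have w2: "(\<nu>\<^sup>2 - 2) * w \<le> 3 / 2"
    using mult_right_mono[OF le(2), of w] w by (simp add: algebra_simps)
  have "real (n\<^sup>2 - 2) = \<nu>\<^sup>2 - 2"
    using nine_le_square[OF n] by (simp add: \<nu>_def of_nat_diff)
  have "(1 + w) ^ (n\<^sup>2 - 2) \<le> exp w ^ (n\<^sup>2 - 2)"
    using w by (intro power_mono exp_ge_add_one_self) auto
  also have "\<dots> = exp ((\<nu>\<^sup>2 - 2) * w)"
    by (simp add: exp_of_nat_mult[symmetric] \<open>real (n\<^sup>2 - 2) = \<nu>\<^sup>2 - 2\<close>)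
  also have "\<dots> \<le> exp (3 / 2)" using w2 by simp
  also have "\<dots> < 6"
  proof (rule power2_less_imp_less)
    have "exp (3 / 2 :: real) ^ 2 = exp 1 ^ 3"
      by (simp flip: exp_of_nat_mult)
    also have "\<dots> \<le> 3 ^ 3" by (intro power_mono exp_le) auto
    finally show "exp (3 / 2 :: real) ^ 2 < 6\<^sup>2" by simp
  qed simp
  finally have pow: "(1 + w) ^ (n\<^sup>2 - 2) < 6" .
  have "(1 + w)\<^sup>2 - \<nu>\<^sup>2 * (1 + w) + \<nu>\<^sup>2 = w\<^sup>2 - (\<nu> - 2) * w"
    using w(2) by (simp add: algebra_simps power2_eq_square)
  then have "(1 + w)\<^sup>2 - \<nu>\<^sup>2 * (1 + w) + \<nu>\<^sup>2 \<ge> - (1 / 6)"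
    using w1 zero_le_power2[of w] by linarith
  then have "(1 + w) ^ (n\<^sup>2 - 2) * ((1 + w)\<^sup>2 - \<nu>\<^sup>2 * (1 + w) + \<nu>\<^sup>2) \<ge>
      (1 + w) ^ (n\<^sup>2 - 2) * - (1 / 6)"
    using w by (intro mult_left_mono) auto
  then have "rescaled_extremal n (1 + w) > -1"
    using pow unfolding rescaled_extremal_def \<nu>_def by linarith
  then show ?thesis by (simp add: w_def \<nu>_def)
qed

text \<open>The endpoint condition keeps \<open>\<bar>Q\<bar>\<close> at most
  \<open>n^(-n^2)\<close> on \<open>[0, u1/n]\<close>, so \<open>Q\<close> certifies
  \<open>t_M <= 1/n\<close>; the interval contains \<open>1/n\<close>, which gives the
  converse.\<close>

lemma t_M_eq_inverse_nat:
  assumes n: "n > 2" and u1: "1 \<le> u1" "u1 \<le> (real n)\<^sup>2 - 2"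
    and ge: "rescaled_extremal n u1 \<ge> -1"
  shows "t_M (u1 / real n) = 1 / real n"
proof (rule antisym)
  show "1 / real n \<le> t_M (u1 / real n)"
    using n u1 by (intro t_M_ge_inverse_nat) (auto simp: divide_right_mono)
  define Q where "Q = monom 1 (n\<^sup>2 - 2) * [:1, - int n, 1:]"
  have n2: "n\<^sup>2 = n\<^sup>2 - 2 + 2" using nine_le_square[OF n] by simp
  have Q: "Q \<in> monic_int_polys (n\<^sup>2)"
    unfolding Q_def
    by (subst n2, intro monic_int_polys_mult monom_in_monic_int_polys)
      (simp add: monic_int_polys_def)
  have scale: "eval_real Q (u / real n) = (1 / real n) ^ n\<^sup>2 * rescaled_extremal n u" for u
  proof -
    have "(1 / real n) ^ n\<^sup>2 = (1 / real n) ^ (n\<^sup>2 - 2) * (1 / real n)\<^sup>2"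
      by (subst n2) (rule power_add)
    moreover have "eval_real [:1, - int n, 1:] (u / real n) =
        (1 / real n)\<^sup>2 * (u\<^sup>2 - (real n)\<^sup>2 * u + (real n)\<^sup>2)"
      using n by (simp add: map_poly_pCons field_simps power2_eq_square)
    moreover have "eval_real (monom 1 (n\<^sup>2 - 2)) (u / real n) =
        (1 / real n) ^ (n\<^sup>2 - 2) * u ^ (n\<^sup>2 - 2)"
      by (simp add: eval_real_monom power_divide)
    ultimately show ?thesis
      unfolding Q_def eval_real_mult rescaled_extremal_def by simp
  qed
  show "t_M (u1 / real n) \<le> 1 / real n"
  proof (rule t_M_le[OF _ _ _ Q])
    show "sup_norm_on Q {0..u1 / real n} \<le> (1 / real n) ^ n\<^sup>2"
    proof (rule sup_norm_on_le)
      fix x assume x: "x \<in> {0..u1 / real n}"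
      then have "\<bar>rescaled_extremal n (x * real n)\<bar> \<le> 1"
        using n by (intro rescaled_extremal_bounded[OF n u1 ge]) (auto simp: field_simps)
      then have "(1 / real n) ^ n\<^sup>2 * \<bar>rescaled_extremal n (x * real n)\<bar> \<le> (1 / real n) ^ n\<^sup>2 * 1"
        by (intro mult_left_mono) auto
      then show "\<bar>eval_real Q x\<bar> \<le> (1 / real n) ^ n\<^sup>2"
        using scale[of "x * real n"] n by (simp add: abs_mult)
    qed (use u1 in auto)
  qed (use n u1 in auto)
qed

text \<open>The inequality at \<open>u0\<close> is strict, so by continuity it survives slightly to
  the right; this makes the lower bound for \<open>b_max\<close> strict.\<close>

lemma ex_t_M_eq_inverse_nat:
  assumes n: "n > 2"
  shows "\<exists>b > 1 / real n + 1 / ((real n)\<^sup>2 * (real n - 1)). t_M b = 1 / real n"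
proof -
  define u0 where "u0 = 1 + 1 / (real n * (real n - 1))"
  have "real n * (real n - 1) \<ge> 3 * 2"
    using n by (intro mult_mono) auto
  then have u0: "1 \<le> u0" "u0 < 2" by (auto simp: u0_def)
  have n2: "(real n)\<^sup>2 \<ge> 9"
    using power_mono[of 3 "real n" 2] n by simp
  have "isCont (rescaled_extremal n) u0"
    using DERIV_rescaled_extremal[OF n] by (rule DERIV_isCont)
  then have "(rescaled_extremal n \<longlongrightarrow> rescaled_extremal n u0) (at_right u0)"
    by (simp add: isCont_def filterlim_at_split)
  then have "\<forall>\<^sub>F u in at_right u0. -1 < rescaled_extremal n u"
    using rescaled_extremal_gt[OF n] by (auto simp: u0_def intro: order_tendstoD)
  \<comment> \<open>The cap 2 keeps \<open>u\<close> below the second critical point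
    \<open>n^2 - 2 >= 7\<close>.\<close>
  moreover have "\<forall>\<^sub>F u in at_right u0. u \<in> {u0<..<2}"
    using u0 by (intro eventually_at_right_real)
  ultimately have "\<forall>\<^sub>F u in at_right u0. -1 < rescaled_extremal n u \<and> u0 < u \<and> u < 2"
    by eventually_elim auto
  then obtain u where u: "-1 < rescaled_extremal n u" "u0 < u" "u < 2"
    using eventually_happens'[OF trivial_limit_at_right_real] by blast
  have "t_M (u / real n) = 1 / real n"
    using u u0 n2 by (intro t_M_eq_inverse_nat n) auto
  moreover have "1 / real n + 1 / ((real n)\<^sup>2 * (real n - 1)) = u0 / real n"
    by (simp add: u0_def add_divide_distrib power2_eq_square)
  then have "1 / real n + 1 / ((real n)\<^sup>2 * (real n - 1)) < u / real n"
    using u n by (simp add: divide_strict_right_mono)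
  ultimately show ?thesis by blast
qed

theorem theorem3p1:
  fixes n :: nat
  assumes "n > 2"
  shows "1 / real n + 1 / ((real n)\<^sup>2 * (real n - 1)) < b_max n \<and>
         b_max n \<le> 4 * real n / (2 * real n - 1)\<^sup>2"
proof
  let ?S = "{b. b > 1 / real n \<and> t_M b = 1 / real n}"
  \<comment> \<open>This bounds \<open>?S\<close> above, and the \<open>b\<close> obtained next
    shows it nonempty, so \<open>Sup\<close> is a genuine supremum.\<close>
  have upper: "b \<le> 4 * real n / (2 * real n - 1)\<^sup>2" if "b \<in> ?S" for b
    using t_M_gt_of_large[OF assms, of b] that by force
  obtain b where b: "b > 1 / real n + 1 / ((real n)\<^sup>2 * (real n - 1))" "t_M b = 1 / real n"
    using ex_t_M_eq_inverse_nat[OF assms] by blast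
  have "1 / ((real n)\<^sup>2 * (real n - 1)) > 0" using assms by simp
  then have "1 / real n < b" using b(1) by linarith
  then have "b \<in> ?S" using b by simp
  then have "b \<le> b_max n"
    unfolding b_max_def using upper by (intro cSup_upper bdd_aboveI)
  then show "1 / real n + 1 / ((real n)\<^sup>2 * (real n - 1)) < b_max n"
    using b by simp
  show "b_max n \<le> 4 * real n / (2 * real n - 1)\<^sup>2"
    unfolding b_max_def using \<open>b \<in> ?S\<close> upper by (intro cSup_least) auto
qed

end
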